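(* For any positive integers $a,b,c$, $\mu_{\mathrm{int}}(S_{a,b,c})\le 2$ and $\mu_{\mathrm{int}}(M_{a,b,c})\le 2$.
   Context: Graphs are finite and simple. A $k$-improper edge coloring of a graph $G$ is a map $\alpha:E(G)\to\mathbb{N}$ such that at most $k$ edges with a common endpoint receive the same color; it is an improper interval coloring if at every vertex the colors on incident edges form a set of consecutive integers. $\mu_{\mathrm{int}}(G)$ is the smallest $k$ such that $G$ has a $k$-improper interval edge coloring. The graph $S_{a,b,c}$ has vertex set $\{u_0,u_1,u_2,u_3,v_1,v_2,v_3\}\cup\{x_1,\dots,x_a,y_1,\dots,y_b,z_1,\dots,z_c\}$ and edge set $\{u_1v_1,v_1u_2,u_2v_2,v_2u_3,u_3v_3,v_3u_1\}\cup\{u_0x_i,u_1x_i:1\le i\le a\}\cup\{u_0y_j,u_2y_j:1\le j\le b\}\cup\{u_0z_k,u_3z_k:1\le k\le c\}$. The graph $M_{a,b,c}$ has vertex set $\{u_0,u_1,u_2,u_3\}\cup\{x_1,\dots,x_a,y_1,\dots,y_b,z_1,\dots,z_c\}$ and edge set $\{u_0x_i,u_1x_i,u_2x_i:1\le i\le a\}\cup\{u_0y_j,u_2y_j,u_3y_j:1\le j\le b\}\cup\{u_0z_k,u_3z_k,u_1z_k:1\le k\le c\}$. *)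

theory Defs
  imports Main
begin

type_synonym 'v graph = "'v set \<times> 'v set set"

abbreviation verts :: "'v graph \<Rightarrow> 'v set" where "verts G \<equiv> fst G"
abbreviation edges :: "'v graph \<Rightarrow> 'v set set" where "edges G \<equiv> snd G"

definition finite_simple_graph :: "'v graph \<Rightarrow> bool" where
  "finite_simple_graph G \<longleftrightarrow>
     finite (verts G) \<and> (\<forall>e\<in>edges G. e \<subseteq> verts G \<and> card e = 2)"

definition incident_edges :: "'v graph \<Rightarrow> 'v \<Rightarrow> 'v set set" where
  "incident_edges G v = {e \<in> edges G. v \<in> e}"

text \<open>A colouring is a total function on vertex sets; only its values on the edges of the
  graph are ever used.\<close>

definition improper_edge_coloring :: "nat \<Rightarrow> 'v graph \<Rightarrow> ('v set \<Rightarrow> nat) \<Rightarrow> bool" where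
  "improper_edge_coloring k G \<alpha> \<longleftrightarrow>
     (\<forall>v\<in>verts G. \<forall>col. card {e \<in> incident_edges G v. \<alpha> e = col} \<le> k)"

text \<open>At an isolated vertex the colour set is empty, which counts as an interval (with \<open>l > h\<close>).\<close>

definition improper_interval_coloring :: "nat \<Rightarrow> 'v graph \<Rightarrow> ('v set \<Rightarrow> nat) \<Rightarrow> bool" where
  "improper_interval_coloring k G \<alpha> \<longleftrightarrow>
     improper_edge_coloring k G \<alpha> \<and>
     (\<forall>v\<in>verts G. \<exists>l h. \<alpha> ` incident_edges G v = {l..h})"

definition mu_int :: "'v graph \<Rightarrow> nat" where
  "mu_int G = (LEAST k. \<exists>\<alpha>. improper_interval_coloring k G \<alpha>)"

text \<open>The minimum is over a nonempty set for every finite simple graph: colour all edges alike.\<close>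

lemma improper_interval_coloring_exists:
  assumes "finite_simple_graph G"
  shows "\<exists>k \<alpha>. improper_interval_coloring k G \<alpha>"
proof -
  have "edges G \<subseteq> Pow (verts G)" "finite (verts G)"
    using assms by (auto simp: finite_simple_graph_def)
  hence fin: "finite (edges G)"
    by (meson finite_Pow_iff finite_subset)
  have "improper_edge_coloring (card (edges G)) G (\<lambda>_. 0)"
    unfolding improper_edge_coloring_def incident_edges_def
    by (auto intro!: card_mono fin)
  moreover have "\<exists>l h. (\<lambda>_. 0 :: nat) ` incident_edges G v = {l..h}" for v
  proof (cases "incident_edges G v = {}")
    case True
    hence "(\<lambda>_. 0 :: nat) ` incident_edges G v = {1..0}" by simp
    thus ?thesis by blast
  next
    case False
    hence "(\<lambda>_. 0 :: nat) ` incident_edges G v = {0..0}" by auto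
    thus ?thesis by blast
  qed
  ultimately show ?thesis
    unfolding improper_interval_coloring_def by blast
qed

lemma mu_int_attained:
  assumes "finite_simple_graph G"
  shows "\<exists>\<alpha>. improper_interval_coloring (mu_int G) G \<alpha>"
  unfolding mu_int_def
  using improper_interval_coloring_exists[OF assms] by (rule LeastI_ex)

datatype vertex = U nat | V nat | X nat | Y nat | Z nat

definition S_graph :: "nat \<Rightarrow> nat \<Rightarrow> nat \<Rightarrow> vertex graph" where
  "S_graph a b c =
    ({U 0, U 1, U 2, U 3, V 1, V 2, V 3} \<union> X ` {1..a} \<union> Y ` {1..b} \<union> Z ` {1..c},
     {{U 1, V 1}, {V 1, U 2}, {U 2, V 2}, {V 2, U 3}, {U 3, V 3}, {V 3, U 1}}
     \<union> (\<Union>i\<in>{1..a}. {{U 0, X i}, {U 1, X i}})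
     \<union> (\<Union>j\<in>{1..b}. {{U 0, Y j}, {U 2, Y j}})
     \<union> (\<Union>k\<in>{1..c}. {{U 0, Z k}, {U 3, Z k}}))"

definition M_graph :: "nat \<Rightarrow> nat \<Rightarrow> nat \<Rightarrow> vertex graph" where
  "M_graph a b c =
    ({U 0, U 1, U 2, U 3} \<union> X ` {1..a} \<union> Y ` {1..b} \<union> Z ` {1..c},
     (\<Union>i\<in>{1..a}. {{U 0, X i}, {U 1, X i}, {U 2, X i}})
     \<union> (\<Union>j\<in>{1..b}. {{U 0, Y j}, {U 2, Y j}, {U 3, Y j}})
     \<union> (\<Union>k\<in>{1..c}. {{U 0, Z k}, {U 3, Z k}, {U 1, Z k}}))"

lemma finite_simple_S_graph: "finite_simple_graph (S_graph a b c)"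
  unfolding finite_simple_graph_def S_graph_def by auto

lemma finite_simple_M_graph: "finite_simple_graph (M_graph a b c)"
  unfolding finite_simple_graph_def M_graph_def by auto

end

theory Submission
  imports Defs
begin

text \<open>
  Colour the \<open>n = a + b + c\<close> positions of a closed walk, first upwards \<open>0, 1, 2, \<dots>\<close> and then
  back down \<open>\<dots>, 2, 1, 0\<close>.  Every colour occurs at most twice per round and neighbouring
  positions differ by at most one, so an arc of at most \<open>n\<close> consecutive positions is always
  coloured admissibly.  The edges at \<open>U 0\<close> go once round, with the \<open>X\<close>, \<open>Y\<close> and
  \<open>Z\<close> edges as three successive arcs, and the edges at every other vertex are placed on
  an arc as well.  The only exception is \<open>U 3\<close> in the graph \<open>M\<close>, whose arc has to skip
  one position; the walk is rotated so that the gap falls on the turning point, where the colour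
  is repeated by the neighbouring position.
\<close>

section \<open>The up-and-down colour pattern\<close>

definition loop :: "nat \<Rightarrow> nat \<Rightarrow> nat" where
  "loop n p = min (p mod n) (n - 1 - p mod n)"

text \<open>Lets a vertex read the position of an edge one round later, so that an arc running past
  the end of a round is still an interval of natural numbers.\<close>

lemma loop_add_period [simp]: "loop n (p + n) = loop n p"
  by (simp add: loop_def)

lemma loop_add_two_periods [simp]: "loop n (p + (n + n)) = loop n p"
  using loop_add_period[of n "p + n"] by (simp add: add.assoc)

text \<open>The last position of a round and the first of the next both have colour 0. This bridges
  the position skipped at \<open>U 3\<close> in \<open>M_graph\<close>.\<close>

lemma loop_turn:
  assumes "n > 0"
  shows "loop n (n + n) = loop n (n + n - 1)"
proof -
  have "loop n (n + n - 1) = loop n (n - 1)"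
    using assms loop_add_period[of n "n - 1"] by simp
  then show ?thesis using assms by (simp add: loop_def)
qed

text \<open>Within a round one argument of the minimum rises by one and the other falls by one;
  between rounds the residues \<open>n - 1\<close> and \<open>0\<close> both give colour 0.\<close>

lemma loop_Suc:
  assumes "n > 0"
  shows "loop n (Suc p) \<le> Suc (loop n p) \<and> loop n p \<le> Suc (loop n (Suc p))"
proof (cases "Suc (p mod n) = n")
  case True
  then show ?thesis by (simp add: loop_def mod_Suc)
next
  case False
  then show ?thesis using mod_less_divisor[OF assms, of p]
    by (auto simp: loop_def mod_Suc)
qed

text \<open>A window of length \<open>n\<close> contains no residue modulo \<open>n\<close> twice,
  and colour \<open>t\<close> can occur only at the residues \<open>t\<close> and
  \<open>n - 1 - t\<close>.\<close>

lemma card_loop_level: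
  assumes "n > 0"
  shows "card {p \<in> {l..<l + n}. loop n p = t} \<le> 2"
proof -
  let ?P = "{p \<in> {l..<l + n}. loop n p = t}"
  have inj: "inj_on (\<lambda>p. p mod n) ?P"
  proof (rule linorder_inj_onI')
    fix p q assume pq: "p \<in> ?P" "q \<in> ?P" "p < q"
    show "p mod n \<noteq> q mod n"
    proof
      assume "p mod n = q mod n"
      then have "n dvd q - p" using mod_eq_dvd_iff_nat[of p q n] pq by simp
      then have "n \<le> q - p" using pq by (simp add: dvd_imp_le)
      then show False using pq by auto
    qed
  qed
  have "r \<in> {t, n - 1 - t}" if "min r (n - 1 - r) = t" "r < n" for r
    using that by (auto simp: min_def split: if_splits)
  then have "p mod n \<in> {t, n - 1 - t}" if "p \<in> ?P" for p
    using that assms by (simp add: loop_def)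
  then have "card ?P \<le> card {t, n - 1 - t}"
    using inj by (intro card_inj_on_le[where f = "\<lambda>p. p mod n"]) auto
  also have "\<dots> \<le> 2" by (simp add: card_insert_if)
  finally show ?thesis .
qed

text \<open>Discrete intermediate value argument: \<open>f (Suc q)\<close> is within one of
  \<open>f q\<close>, which already lies in the interval, so each step extends the interval by at
  most one point.\<close>

lemma image_interval_slow:
  fixes f :: "nat \<Rightarrow> nat"
  assumes slow: "\<And>p. f (Suc p) \<le> Suc (f p) \<and> f p \<le> Suc (f (Suc p))"
    and "p \<le> q"
  shows "\<exists>l h. f ` {p..q} = {l..h}"
  using \<open>p \<le> q\<close>
proof (induction q rule: dec_induct)
  case base
  have "f ` {p..p} = {f p..f p}" by simp
  then show ?case by blast
next
  case (step q)
  then obtain l h where lh: "f ` {p..q} = {l..h}" by blast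
  have "f q \<in> {l..h}" using lh step.hyps by (metis atLeastAtMost_iff image_eqI order_refl)
  moreover have "f ` {p..Suc q} = insert (f (Suc q)) {l..h}"
    using lh step.hyps by (simp add: atLeastAtMostSuc_conv)
  ultimately have "f ` {p..Suc q} = {min l (f (Suc q))..max h (f (Suc q))}"
    using slow[of q] by (auto simp: min_def max_def)
  then show ?case by blast
qed

section \<open>Checking one vertex by placing its edges on positions\<close>

definition good_at :: "'v graph \<Rightarrow> ('v set \<Rightarrow> nat) \<Rightarrow> 'v \<Rightarrow> bool" where
  "good_at G \<alpha> v \<longleftrightarrow> (\<forall>t. card {e \<in> incident_edges G v. \<alpha> e = t} \<le> 2) \<and>
    (\<exists>l h. \<alpha> ` incident_edges G v = {l..h})"

lemma mu_int_le_2: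
  assumes "\<And>v. v \<in> verts G \<Longrightarrow> good_at G \<alpha> v"
  shows "mu_int G \<le> 2"
proof -
  have "improper_interval_coloring 2 G \<alpha>"
    using assms
    unfolding improper_interval_coloring_def improper_edge_coloring_def good_at_def by blast
  then show ?thesis unfolding mu_int_def by (auto intro: Least_le)
qed

lemma good_at_loop:
  assumes inc: "incident_edges G v = (\<lambda>w. {v, w}) ` N"
    and col: "\<And>w. w \<in> N \<Longrightarrow> \<alpha> {v, w} = loop n (\<psi> w)"
    and inj: "inj_on \<psi> N"
    and sub: "\<psi> ` N \<subseteq> {l..<l + n}"
    and img: "loop n ` \<psi> ` N = loop n ` {p..q}"
    and "p \<le> q" "n > 0"
  shows "good_at G \<alpha> v"
proof -
  have fin: "finite N" using inj sub by (meson finite_atLeastLessThan inj_on_finite)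
  have "card {e \<in> incident_edges G v. \<alpha> e = t} \<le> 2" for t
  proof -
    let ?M = "{w \<in> N. loop n (\<psi> w) = t}"
    have "{e \<in> incident_edges G v. \<alpha> e = t} = (\<lambda>w. {v, w}) ` ?M"
      using inc col by auto
    then have "card {e \<in> incident_edges G v. \<alpha> e = t} \<le> card ?M"
      using fin by (simp add: card_image_le)
    also have "\<dots> \<le> card {p \<in> {l..<l + n}. loop n p = t}"
      using inj sub by (intro card_inj_on_le[where f = \<psi>]) (auto intro: inj_on_subset)
    also have "\<dots> \<le> 2" using card_loop_level \<open>n > 0\<close> by simp
    finally show ?thesis .
  qed
  moreover have "\<alpha> ` incident_edges G v = loop n ` {p..q}"
    using col unfolding inc img[symmetric] by (force simp: image_image)
  ultimately show ?thesis
    using image_interval_slow[of "loop n", OF loop_Suc[OF \<open>n > 0\<close>] \<open>p \<le> q\<close>]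
    unfolding good_at_def by auto
qed

text \<open>The case without gaps: the window starts at \<open>p\<close>, and
  \<open>q < p + n\<close> makes the arc fit into it.\<close>

lemma good_at_arc:
  assumes "incident_edges G v = (\<lambda>w. {v, w}) ` N"
    and "\<And>w. w \<in> N \<Longrightarrow> \<alpha> {v, w} = loop n (\<psi> w)"
    and "inj_on \<psi> N"
    and "\<psi> ` N = {p..q}"
    and "p \<le> q" "q < p + n"
  shows "good_at G \<alpha> v"
  using assms by (intro good_at_loop[where N = N and \<psi> = \<psi> and n = n and l = p]) auto

section \<open>Computing incident edges and edge colours\<close>

lemma incident_edges_simps:
  "incident_edges (W, {}) v = {}"
  "incident_edges (W, insert e A) v =
     (if v \<in> e then insert e (incident_edges (W, A) v) else incident_edges (W, A) v)"
  "incident_edges (W, A \<union> B) v = incident_edges (W, A) v \<union> incident_edges (W, B) v"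
  "incident_edges (W, \<Union>i\<in>I. C i) v = (\<Union>i\<in>I. incident_edges (W, C i) v)"
  by (auto simp: incident_edges_def)

text \<open>Turns a function on ordered pairs into one on edges; the functions \<open>w\<close> used below
  vanish on all but one of the four pairs contributing to an edge.\<close>

definition edge_col :: "('v \<Rightarrow> 'v \<Rightarrow> nat) \<Rightarrow> 'v set \<Rightarrow> nat" where
  "edge_col w e = (\<Sum>u\<in>e. \<Sum>v\<in>e. w u v)"

lemma edge_col_doubleton:
  "u \<noteq> v \<Longrightarrow> edge_col w {u, v} = w u u + w u v + (w v u + w v v)"
  by (simp add: edge_col_def)

section \<open>The graph S\<close>

text \<open>At \<open>U 0\<close> the \<open>X\<close>, \<open>Y\<close> and \<open>Z\<close> edges
  take the positions 1 to \<open>n = a + b + c\<close> in this order; the second edge at each of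
  these neighbours comes one position later. The \<open>V\<close> edges add one position at either
  end of the resulting arcs at \<open>U 1\<close>, \<open>U 2\<close> and
  \<open>U 3\<close>.\<close>

fun S_col :: "nat \<Rightarrow> nat \<Rightarrow> nat \<Rightarrow> vertex \<Rightarrow> vertex \<Rightarrow> nat" where
  "S_col a b c (U r) (X i) = loop (a + b + c) (if r = 0 then i else i + 1)"
| "S_col a b c (U r) (Y i) = loop (a + b + c) (if r = 0 then i + a else i + (a + 1))"
| "S_col a b c (U r) (Z i) = loop (a + b + c) (if r = 0 then i + (a + b) else i + (a + b + 1))"
| "S_col a b c (U r) (V s) = loop (a + b + c)
     (if r = 1 then (if s = 1 then a + 2 else 1)
      else if r = 2 then (if s = 1 then a + 1 else a + b + 2)
      else (if s = 2 then a + b + 1 else 2))"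
| "S_col a b c _ _ = 0"

lemma mu_int_S:
  assumes pos: "a > 0" "b > 0" "c > 0"
  shows "mu_int (S_graph a b c) \<le> 2"
proof (rule mu_int_le_2)
  let ?n = "a + b + c" and ?G = "S_graph a b c"
  let ?\<alpha> = "edge_col (S_col a b c)"
  fix v assume "v \<in> verts ?G"
  then consider "v = U 0" | "v = U 1" | "v = U 2" | "v = U 3" | "v = V 1" | "v = V 2" | "v = V 3"
    | i where "v = X i" "i \<in> {1..a}" | i where "v = Y i" "i \<in> {1..b}"
    | i where "v = Z i" "i \<in> {1..c}"
    by (auto simp: S_graph_def)
  then show "good_at ?G ?\<alpha> v"
  proof cases
    case 1
    let ?\<psi> = "\<lambda>w. case w of X i \<Rightarrow> i
      | Y i \<Rightarrow> i + a | Z i \<Rightarrow> i + (a + b)"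
    let ?N = "X ` {1..a} \<union> Y ` {1..b} \<union> Z ` {1..c}"
    show ?thesis
    proof (rule good_at_arc[where N = ?N and n = ?n and \<psi> = ?\<psi> and p = 1 and q = ?n])
      show "incident_edges ?G v = (\<lambda>w. {v, w}) ` ?N"
        using 1 by (simp add: S_graph_def incident_edges_simps image_Un image_image
          UNION_singleton_eq_range)
      show "?\<psi> ` ?N = {1..?n}"
        unfolding image_Un image_image vertex.case image_add_atLeastAtMost' using pos by auto
    qed (use pos 1 in \<open>auto simp: edge_col_doubleton inj_on_def\<close>)
  next
    case 2
    \<comment> \<open>The edges to \<open>V 3\<close> and \<open>V 1\<close> flank the
      \<open>X\<close> positions 2 to \<open>a + 1\<close>. The arc of \<open>a + 2\<close>
      positions fits into one round because \<open>b\<close> and \<open>c\<close> are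
      positive.\<close>
    let ?\<psi> = "\<lambda>w. case w of X i \<Rightarrow> i + 1 | V i \<Rightarrow> if i = 1 then a + 2 else 1"
    let ?N = "X ` {1..a} \<union> {V 1, V 3}"
    show ?thesis
    proof (rule good_at_arc[where N = ?N and n = ?n and \<psi> = ?\<psi> and p = 1 and q = "a + 2"])
      show "incident_edges ?G v = (\<lambda>w. {v, w}) ` ?N"
        using 2 by (simp add: S_graph_def incident_edges_simps image_Un image_image
          UNION_singleton_eq_range insert_commute[of "V _" "U _" "{}"])
      show "?\<psi> ` ?N = {1..a + 2}"
        unfolding image_Un image_image vertex.case image_add_atLeastAtMost' using pos by auto
    qed (use pos 2 in \<open>auto simp: edge_col_doubleton inj_on_def\<close>)
  next
    case 3
    let ?\<psi> = "\<lambda>w. case w of Y i \<Rightarrow> i + (a + 1) | V i \<Rightarrow> if i = 1 then a + 1 else a + b + 2"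
    let ?N = "Y ` {1..b} \<union> {V 1, V 2}"
    show ?thesis
    proof (rule good_at_arc[where N = ?N and n = ?n and \<psi> = ?\<psi>
          and p = "a + 1" and q = "a + b + 2"])
      show "incident_edges ?G v = (\<lambda>w. {v, w}) ` ?N"
        using 3 by (simp add: S_graph_def incident_edges_simps image_Un image_image
          UNION_singleton_eq_range insert_commute[of "V _" "U _" "{}"])
      show "?\<psi> ` ?N = {a + 1..a + b + 2}"
        unfolding image_Un image_image vertex.case image_add_atLeastAtMost' using pos by auto
    qed (use pos 3 in \<open>auto simp: edge_col_doubleton inj_on_def\<close>)
  next
    case 4
    \<comment> \<open>The edge to \<open>V 3\<close> has position 2 in \<open>S_col\<close>; here it
      is read one round later, directly after the last \<open>Z\<close> position
      \<open>?n + 1\<close>.\<close>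
    let ?\<psi> = "\<lambda>w. case w of Z i \<Rightarrow> i + (a + b + 1) | V i \<Rightarrow> if i = 2 then a + b + 1 else 2 + ?n"
    let ?N = "Z ` {1..c} \<union> {V 2, V 3}"
    show ?thesis
    proof (rule good_at_arc[where N = ?N and n = ?n and \<psi> = ?\<psi>
          and p = "a + b + 1" and q = "2 + ?n"])
      show "incident_edges ?G v = (\<lambda>w. {v, w}) ` ?N"
        using 4 by (simp add: S_graph_def incident_edges_simps image_Un image_image
          UNION_singleton_eq_range insert_commute[of "V _" "U _" "{}"])
      show "?\<psi> ` ?N = {a + b + 1..2 + ?n}"
        unfolding image_Un image_image vertex.case image_add_atLeastAtMost' using pos by auto
      show "?\<alpha> {v, w} = loop ?n (?\<psi> w)" if "w \<in> ?N" for w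
        using that 4 loop_add_period[of ?n 2]
        by (auto simp: edge_col_doubleton simp del: loop_add_period)
    qed (use pos 4 in \<open>auto simp: inj_on_def\<close>)
  next
    case 5
    \<comment> \<open>The arcs \<open>{1..a + 2}\<close> at \<open>U 1\<close> and
      \<open>{a + 1..a + b + 2}\<close> at \<open>U 2\<close> share exactly these two positions: the
      edge to \<open>U 1\<close> ends the former and the edge to \<open>U 2\<close> starts the
      latter.\<close>
    let ?\<psi> = "\<lambda>w. if w = U 1 then a + 2 else a + 1"
    let ?N = "{U 1, U 2}"
    show ?thesis
    proof (rule good_at_arc[where N = ?N and n = ?n and \<psi> = ?\<psi>
          and p = "a + 1" and q = "a + 2"])
      show "incident_edges ?G v = (\<lambda>w. {v, w}) ` ?N"
        using 5 by (simp add: S_graph_def incident_edges_simps image_Un image_image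
          UNION_singleton_eq_range insert_commute[of "U _" "V _" "{}"])
      show "?\<psi> ` ?N = {a + 1..a + 2}"
        using pos by auto
    qed (use pos 5 in \<open>auto simp: edge_col_doubleton inj_on_def\<close>)
  next
    case 6
    let ?\<psi> = "\<lambda>w. if w = U 2 then a + b + 2 else a + b + 1"
    let ?N = "{U 2, U 3}"
    show ?thesis
    proof (rule good_at_arc[where N = ?N and n = ?n and \<psi> = ?\<psi>
          and p = "a + b + 1" and q = "a + b + 2"])
      show "incident_edges ?G v = (\<lambda>w. {v, w}) ` ?N"
        using 6 by (simp add: S_graph_def incident_edges_simps image_Un image_image
          UNION_singleton_eq_range insert_commute[of "U _" "V _" "{}"])
      show "?\<psi> ` ?N = {a + b + 1..a + b + 2}"
        using pos by auto
    qed (use pos 6 in \<open>auto simp: edge_col_doubleton inj_on_def\<close>)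
  next
    case 7
    let ?\<psi> = "\<lambda>w. if w = U 1 then 1 else (2 :: nat)"
    let ?N = "{U 1, U 3}"
    show ?thesis
    proof (rule good_at_arc[where N = ?N and n = ?n and \<psi> = ?\<psi> and p = 1 and q = 2])
      show "incident_edges ?G v = (\<lambda>w. {v, w}) ` ?N"
        using 7 by (auto simp: S_graph_def incident_edges_simps
          insert_commute[of "U _" "V _" "{}"])
      show "?\<psi> ` ?N = {1..2}"
        using pos by auto
    qed (use pos 7 in \<open>auto simp: edge_col_doubleton inj_on_def\<close>)
  next
    case (8 i)
    let ?\<psi> = "\<lambda>w. if w = U 0 then i else i + 1"
    let ?N = "{U 0, U 1}"
    show ?thesis
    proof (rule good_at_arc[where N = ?N and n = ?n and \<psi> = ?\<psi> and p = i and q = "i + 1"])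
      show "incident_edges ?G v = (\<lambda>w. {v, w}) ` ?N"
        using 8 by (auto simp: S_graph_def incident_edges_simps
          insert_commute[of "U _" "X _" "{}"])
      show "?\<psi> ` ?N = {i..i + 1}"
        using pos by auto
    qed (use pos 8 in \<open>auto simp: edge_col_doubleton inj_on_def\<close>)
  next
    case (9 i)
    let ?\<psi> = "\<lambda>w. if w = U 0 then i + a else i + (a + 1)"
    let ?N = "{U 0, U 2}"
    show ?thesis
    proof (rule good_at_arc[where N = ?N and n = ?n and \<psi> = ?\<psi>
          and p = "i + a" and q = "i + a + 1"])
      show "incident_edges ?G v = (\<lambda>w. {v, w}) ` ?N"
        using 9 by (auto simp: S_graph_def incident_edges_simps
          insert_commute[of "U _" "Y _" "{}"])
      show "?\<psi> ` ?N = {i + a..i + a + 1}"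
        using pos by auto
    qed (use pos 9 in \<open>auto simp: edge_col_doubleton inj_on_def\<close>)
  next
    case (10 i)
    let ?\<psi> = "\<lambda>w. if w = U 0 then i + (a + b) else i + (a + b + 1)"
    let ?N = "{U 0, U 3}"
    show ?thesis
    proof (rule good_at_arc[where N = ?N and n = ?n and \<psi> = ?\<psi>
          and p = "i + a + b" and q = "i + a + b + 1"])
      show "incident_edges ?G v = (\<lambda>w. {v, w}) ` ?N"
        using 10 by (auto simp: S_graph_def incident_edges_simps
          insert_commute[of "U _" "Z _" "{}"])
      show "?\<psi> ` ?N = {i + a + b..i + a + b + 1}"
        unfolding image_Un image_image vertex.case image_add_atLeastAtMost' using pos by auto
    qed (use pos 10 in \<open>auto simp: edge_col_doubleton inj_on_def\<close>)
  qed
qed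

section \<open>The graph M\<close>

text \<open>Relative to \<open>U 0\<close>, the positions are shifted by 1 towards
  \<open>U 1\<close> and by -1 towards \<open>U 2\<close>. Towards \<open>U 3\<close> the shift is 1
  on the \<open>Y\<close> edges but 2 on the \<open>Z\<close> edges, where shift 1 belongs to
  \<open>U 1\<close>. The summand \<open>n\<close> keeps the subtractions from truncating.\<close>

fun M_col :: "nat \<Rightarrow> nat \<Rightarrow> nat \<Rightarrow> vertex \<Rightarrow> vertex \<Rightarrow> nat" where
  "M_col a b c (U r) (X i) = (let n = a + b + c in
     loop n (i + (if r = 0 then n + c - 2 else if r = 1 then n + c - 1 else n + c - 3)))"
| "M_col a b c (U r) (Y i) = (let n = a + b + c in
     loop n (i + (if r = 0 then n + c + a - 2 else if r = 2 then n + c + a - 3 else n + c + a - 1)))"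
| "M_col a b c (U r) (Z i) = (let n = a + b + c in
     loop n (i + (if r = 0 then n - 2 else if r = 1 then n - 1 else n)))"
| "M_col a b c _ _ = 0"

lemma mu_int_M:
  assumes pos: "a > 0" "b > 0" "c > 0"
  shows "mu_int (M_graph a b c) \<le> 2"
proof (rule mu_int_le_2)
  let ?n = "a + b + c" and ?G = "M_graph a b c"
  let ?\<alpha> = "edge_col (M_col a b c)"
  fix v assume "v \<in> verts ?G"
  then consider "v = U 0" | "v = U 1" | "v = U 2" | "v = U 3"
    | i where "v = X i" "i \<in> {1..a}" | i where "v = Y i" "i \<in> {1..b}"
    | i where "v = Z i" "i \<in> {1..c}"
    by (auto simp: M_graph_def)
  then show "good_at ?G ?\<alpha> v"
  proof cases
    case 1
    \<comment> \<open>The order is \<open>Z\<close>, \<open>X\<close>, \<open>Y\<close>. Starting at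
      \<open>?n - 1\<close> fixes the rotation: the last \<open>Y\<close> position
      \<open>?n + ?n - 2\<close> becomes \<open>?n + ?n - 1\<close> at \<open>U 3\<close>, and the
      first \<open>Z\<close> position, one round later, becomes \<open>?n + ?n + 1\<close>, which
      leaves the gap at \<open>?n + ?n\<close>.\<close>
    let ?\<psi> = "\<lambda>w. case w of X i \<Rightarrow> i + (?n + c - 2)
      | Y i \<Rightarrow> i + (?n + c + a - 2) | Z i \<Rightarrow> i + (?n - 2)"
    let ?N = "X ` {1..a} \<union> Y ` {1..b} \<union> Z ` {1..c}"
    show ?thesis
    proof (rule good_at_arc[where N = ?N and n = ?n and \<psi> = ?\<psi>
          and p = "?n - 1" and q = "?n + ?n - 2"])
      show "incident_edges ?G v = (\<lambda>w. {v, w}) ` ?N"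
        using 1 by (simp add: M_graph_def incident_edges_simps image_Un image_image
          UNION_singleton_eq_range)
      show "?\<psi> ` ?N = {?n - 1..?n + ?n - 2}"
        unfolding image_Un image_image vertex.case image_add_atLeastAtMost' using pos by auto
    qed (use pos 1 in \<open>auto simp: edge_col_doubleton inj_on_def Let_def\<close>)
  next
    case 2
    let ?\<psi> = "\<lambda>w. case w of X i \<Rightarrow> i + (?n + c - 1) | Z i \<Rightarrow> i + (?n - 1)"
    let ?N = "X ` {1..a} \<union> Z ` {1..c}"
    show ?thesis
    proof (rule good_at_arc[where N = ?N and n = ?n and \<psi> = ?\<psi>
          and p = ?n and q = "?n + c + a - 1"])
      show "incident_edges ?G v = (\<lambda>w. {v, w}) ` ?N"
        using 2 by (simp add: M_graph_def incident_edges_simps image_Un image_image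
          UNION_singleton_eq_range)
      show "?\<psi> ` ?N = {?n..?n + c + a - 1}"
        unfolding image_Un image_image vertex.case image_add_atLeastAtMost' using pos by auto
    qed (use pos 2 in \<open>auto simp: edge_col_doubleton inj_on_def Let_def\<close>)
  next
    case 3
    let ?\<psi> = "\<lambda>w. case w of X i \<Rightarrow> i + (?n + c - 3)
      | Y i \<Rightarrow> i + (?n + c + a - 3)"
    let ?N = "X ` {1..a} \<union> Y ` {1..b}"
    show ?thesis
    proof (rule good_at_arc[where N = ?N and n = ?n and \<psi> = ?\<psi>
          and p = "?n + c - 2" and q = "?n + c + a + b - 3"])
      show "incident_edges ?G v = (\<lambda>w. {v, w}) ` ?N"
        using 3 by (simp add: M_graph_def incident_edges_simps image_Un image_image
          UNION_singleton_eq_range)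
      show "?\<psi> ` ?N = {?n + c - 2..?n + c + a + b - 3}"
        unfolding image_Un image_image vertex.case image_add_atLeastAtMost' using pos by auto
    qed (use pos 3 in \<open>auto simp: edge_col_doubleton inj_on_def Let_def\<close>)
  next
    case 4
    let ?\<psi> = "\<lambda>w. case w of Y i \<Rightarrow> i + (?n + c + a - 1) | Z i \<Rightarrow> i + (?n + ?n)"
    let ?N = "Y ` {1..b} \<union> Z ` {1..c}"
    show ?thesis
    \<comment> \<open>The last position \<open>?n + ?n + c\<close> lies in the window of length
      \<open>?n\<close> from \<open>?n + c + a\<close> because \<open>a\<close> is positive.\<close>
    proof (rule good_at_loop[where N = ?N and n = ?n and \<psi> = ?\<psi> and l = "?n + c + a"
          and p = "?n + c + a" and q = "?n + ?n + c"])
      show "incident_edges ?G v = (\<lambda>w. {v, w}) ` ?N"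
        using 4 by (simp add: M_graph_def incident_edges_simps image_Un image_image
          UNION_singleton_eq_range)
      \<comment> \<open>The skipped position has the colour of its predecessor, which is the
        position of the edge to \<open>Y b\<close>; filling the gap therefore adds no
        colour.\<close>
      have "loop ?n (?n + ?n) = loop ?n (?n + ?n - 1)"
        using loop_turn pos by simp
      moreover have "?n + ?n - 1 \<in> ?\<psi> ` ?N"
        unfolding image_Un image_image vertex.case image_add_atLeastAtMost' using pos by auto
      moreover have "{?n + c + a..?n + ?n + c} = insert (?n + ?n) (?\<psi> ` ?N)"
        unfolding image_Un image_image vertex.case image_add_atLeastAtMost' using pos by auto
      ultimately show "loop ?n ` ?\<psi> ` ?N = loop ?n ` {?n + c + a..?n + ?n + c}"
        by (auto simp del: loop_add_period)
    qed (use pos 4 in \<open>auto simp: edge_col_doubleton inj_on_def Let_def\<close>)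
  next
    case (5 i)
    \<comment> \<open>The shifts -1, 0, 1 give three consecutive positions, which fit into one round
      since \<open>?n\<close> is at least 3.\<close>
    let ?\<psi> = "\<lambda>w. i + (if w = U 0 then ?n + c - 2
      else if w = U 1 then ?n + c - 1 else ?n + c - 3)"
    let ?N = "{U 0, U 1, U 2}"
    show ?thesis
    proof (rule good_at_arc[where N = ?N and n = ?n and \<psi> = ?\<psi>
          and p = "i + (?n + c - 3)" and q = "i + (?n + c - 3) + 2"])
      show "incident_edges ?G v = (\<lambda>w. {v, w}) ` ?N"
        using 5 by (auto simp: M_graph_def incident_edges_simps
          insert_commute[of "U _" "X _" "{}"])
      show "?\<psi> ` ?N = {i + (?n + c - 3)..i + (?n + c - 3) + 2}"
        using pos by auto
    qed (use pos 5 in \<open>auto simp: edge_col_doubleton inj_on_def Let_def\<close>)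
  next
    case (6 i)
    let ?\<psi> = "\<lambda>w. i + (if w = U 0 then ?n + c + a - 2
      else if w = U 2 then ?n + c + a - 3 else ?n + c + a - 1)"
    let ?N = "{U 0, U 2, U 3}"
    show ?thesis
    proof (rule good_at_arc[where N = ?N and n = ?n and \<psi> = ?\<psi>
          and p = "i + (?n + c + a - 3)" and q = "i + (?n + c + a - 3) + 2"])
      show "incident_edges ?G v = (\<lambda>w. {v, w}) ` ?N"
        using 6 by (auto simp: M_graph_def incident_edges_simps
          insert_commute[of "U _" "Y _" "{}"])
      show "?\<psi> ` ?N = {i + (?n + c + a - 3)..i + (?n + c + a - 3) + 2}"
        using pos by auto
    qed (use pos 6 in \<open>auto simp: edge_col_doubleton inj_on_def Let_def\<close>)
  next
    case (7 i)
    let ?\<psi> = "\<lambda>w. i + (if w = U 0 then ?n - 2 else if w = U 1 then ?n - 1 else ?n)"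
    let ?N = "{U 0, U 1, U 3}"
    show ?thesis
    proof (rule good_at_arc[where N = ?N and n = ?n and \<psi> = ?\<psi>
          and p = "i + (?n - 2)" and q = "i + (?n - 2) + 2"])
      show "incident_edges ?G v = (\<lambda>w. {v, w}) ` ?N"
        using 7 by (auto simp: M_graph_def incident_edges_simps
          insert_commute[of "U _" "Z _" "{}"])
      show "?\<psi> ` ?N = {i + (?n - 2)..i + (?n - 2) + 2}"
        using pos by auto
    qed (use pos 7 in \<open>auto simp: edge_col_doubleton inj_on_def Let_def\<close>)
  qed
qed

theorem theorem7:
  fixes a b c :: nat
  assumes "a > 0" and "b > 0" and "c > 0"
  shows "mu_int (S_graph a b c) \<le> 2 \<and> mu_int (M_graph a b c) \<le> 2"
  using mu_int_S[OF assms] mu_int_M[OF assms] by blast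

end
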